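(* Let $0<q<1$, let $m,n$ be nonnegative integers, let $f(x,y)$ be a function of two variables and $r,s>0$ such that all transforms involved converge. Then $$\mathcal{L}^{(1)}_{2,q}\big[x^my^nf(x,y)\big](r,s)=(-1)^{m+n}q^{\binom m2+\binom n2}\,\frac{\partial_q^{m+n}}{\partial_qs^n\,\partial_qr^m}\Big(\mathcal{L}^{(1)}_{2,q}[f(x,y)]\big(q^{-m}r,q^{-n}s\big)\Big),$$ where the partial $q$-derivatives are those of the function $(r,s)\mapsto\mathcal{L}^{(1)}_{2,q}[f(x,y)](q^{-m}r,q^{-n}s)$.
   Context: Fix $0<q<1$. Notation: $[n]_q!=\prod_{k=1}^n\frac{1-q^k}{1-q}$, $[0]_q!=1$. The partial $q$-derivative is $\frac{\partial_qF}{\partial_qr}(r,s)=\frac{F(r,s)-F(qr,s)}{(1-q)r}$ for $r\neq0$, similarly in $s$, and higher $q$-derivatives are iterates. The improper Jackson $q$-integral is $\int_0^\infty f(x)\,d_qx=(1-q)\sum_{k\in\mathbb{Z}}q^kf(q^k)$, and double $q$-integrals are the corresponding double series; integrals are understood where these series converge absolutely, and a term in which a factor $E_q$ of the kernel vanishes is taken to be $0$. The big $q$-exponential is the entire function $E_q(z)=\sum_{n\ge0}\frac{q^{\binom n2}}{[n]_q!}z^n$. The double $q$-Laplace transform of the first kind is $$\mathcal{L}^{(1)}_{2,q}[f(x,y)](r,s)=\int_0^\infty\!\!\int_0^\infty f(x,y)E_q(-qrx)E_q(-qsy)\,d_qx\,d_qy,\qquad r,s>0.$$ The transforms required to converge are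 that of $x^my^nf$ at $(r,s)$ and those of $f$ at the points $(q^{-i}r,q^{-j}s)$, $0\le i\le m$, $0\le j\le n$. *)

theory Defs
  imports "HOL-Analysis.Analysis"
begin

definition q_fact :: "real \<Rightarrow> nat \<Rightarrow> real" where
  "q_fact q n = (\<Prod>k=1..n. (1 - q ^ k) / (1 - q))"

definition big_q_exp :: "real \<Rightarrow> complex \<Rightarrow> complex" where
  "big_q_exp q z = (\<Sum>n. complex_of_real (q ^ (n choose 2) / q_fact q n) * z ^ n)"

definition q_deriv_fst :: "real \<Rightarrow> (real \<Rightarrow> real \<Rightarrow> complex) \<Rightarrow> real \<Rightarrow> real \<Rightarrow> complex" where
  "q_deriv_fst q F r s = (F r s - F (q * r) s) / complex_of_real ((1 - q) * r)"

definition q_deriv_snd :: "real \<Rightarrow> (real \<Rightarrow> real \<Rightarrow> complex) \<Rightarrow> real \<Rightarrow> real \<Rightarrow> complex" where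
  "q_deriv_snd q F r s = (F r s - F r (q * s)) / complex_of_real ((1 - q) * s)"

definition jackson2_term :: "real \<Rightarrow> (real \<Rightarrow> real \<Rightarrow> complex) \<Rightarrow> int \<times> int \<Rightarrow> complex" where
  "jackson2_term q g = (\<lambda>(i, j). complex_of_real (q powi i * q powi j) * g (q powi i) (q powi j))"

definition jackson2_converges :: "real \<Rightarrow> (real \<Rightarrow> real \<Rightarrow> complex) \<Rightarrow> bool" where
  "jackson2_converges q g \<longleftrightarrow> (\<lambda>p. norm (jackson2_term q g p)) summable_on UNIV"

definition jackson2_integral :: "real \<Rightarrow> (real \<Rightarrow> real \<Rightarrow> complex) \<Rightarrow> complex" where
  "jackson2_integral q g = complex_of_real ((1 - q)\<^sup>2) * (\<Sum>\<^sub>\<infinity>p. jackson2_term q g p)"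

text \<open>Since \<open>f\<close> is total, a term in which a factor \<open>big_q_exp\<close> vanishes is \<open>0\<close> automatically.\<close>
definition q_laplace2_integrand ::
  "real \<Rightarrow> (real \<Rightarrow> real \<Rightarrow> complex) \<Rightarrow> real \<Rightarrow> real \<Rightarrow> real \<Rightarrow> real \<Rightarrow> complex" where
  "q_laplace2_integrand q f r s x y =
     f x y * big_q_exp q (complex_of_real (- q * r * x)) * big_q_exp q (complex_of_real (- q * s * y))"

definition q_laplace2_converges :: "real \<Rightarrow> (real \<Rightarrow> real \<Rightarrow> complex) \<Rightarrow> real \<Rightarrow> real \<Rightarrow> bool" where
  "q_laplace2_converges q f r s \<longleftrightarrow> jackson2_converges q (q_laplace2_integrand q f r s)"

definition q_laplace2 :: "real \<Rightarrow> (real \<Rightarrow> real \<Rightarrow> complex) \<Rightarrow> real \<Rightarrow> real \<Rightarrow> complex" where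
  "q_laplace2 q f r s = jackson2_integral q (q_laplace2_integrand q f r s)"

end

theory Submission
  imports Defs
begin

text \<open>The functional equation \<open>E\<^sub>q(z) - E\<^sub>q(qz) = (1 - q) z E\<^sub>q(qz)\<close> shows that a \<open>q\<close>-derivative in \<open>r\<close>
  of the kernel \<open>E\<^sub>q(-qrx)\<close> equals \<open>-qx\<close> times the kernel at \<open>qr\<close>. Hence each \<open>q\<close>-derivative of the
  transform multiplies \<open>f\<close> by \<open>-qx\<close> and moves the evaluation point from \<open>r\<close> to \<open>qr\<close>; the shift to
  \<open>q\<^sup>-\<^sup>m r\<close> compensates for \<open>m\<close> such moves.\<close>

section \<open>Convergence and functional equation of the big q-exponential\<close>

lemma q_fact_Suc: "q_fact q (Suc n) = (1 - q ^ Suc n) / (1 - q) * q_fact q n"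
  by (simp add: q_fact_def)

lemma q_fact_pos:
  assumes "0 < q" "q < 1"
  shows "q_fact q n > 0"
  unfolding q_fact_def using assms
  by (intro prod_pos) (auto simp: power_less_one_iff)

text \<open>Since binom(n+1,2) = n + binom(n,2), consecutive terms have norm ratio
  \<open>q ^ n * norm z / b\<close> with \<open>b\<close> at least 1. This tends to 0 for every
  \<open>z\<close>, so it eventually drops below 1/2, an arbitrary bound less than 1.\<close>

lemma summable_big_q_exp:
  fixes z :: complex
  assumes "0 < q" "q < 1"
  shows "summable (\<lambda>n. complex_of_real (q ^ (n choose 2) / q_fact q n) * z ^ n)"
proof -
  have "(\<lambda>n. q ^ n * norm z) \<longlonglongrightarrow> 0 * norm z"
    using assms by (intro tendsto_intros LIMSEQ_realpow_zero) auto
  then have "eventually (\<lambda>n. q ^ n * norm z < 1 / 2) sequentially"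
    by (intro order_tendstoD) auto
  then obtain N where N: "\<And>n. n \<ge> N \<Longrightarrow> q ^ n * norm z < 1 / 2"
    by (auto simp: eventually_sequentially)
  show ?thesis
  proof (rule summable_ratio_test[of "1 / 2" N])
    fix n assume "N \<le> n"
    define b where "b = (1 - q ^ Suc n) / (1 - q)"
    define a where "a = q ^ (n choose 2) / q_fact q n * norm z ^ n"
    have "q ^ Suc n \<le> q"
      using assms power_decreasing[of 1 "Suc n" q] by simp
    then have "b \<ge> 1"
      using assms by (simp add: b_def divide_simps)
    have "a \<ge> 0"
      using assms q_fact_pos[OF assms, of n] by (simp add: a_def)
    have ch: "Suc n choose 2 = n + (n choose 2)"
      by (simp add: numeral_2_eq_2)
    have pos: "q_fact q k > 0" for k
      using q_fact_pos[OF assms] .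
    have "norm (complex_of_real (q ^ (Suc n choose 2) / q_fact q (Suc n)) * z ^ Suc n)
          = (q ^ n * norm z) * a / b"
      unfolding norm_mult norm_of_real norm_power ch
      using assms pos[of n] pos[of "Suc n"] \<open>b \<ge> 1\<close>
      by (simp add: a_def q_fact_Suc b_def[symmetric] power_add field_simps del: power_Suc)
        (simp add: mult_ac)
    also have "\<dots> \<le> (q ^ n * norm z) * a"
      using \<open>b \<ge> 1\<close> \<open>a \<ge> 0\<close> assms divide_left_mono[of 1 b "q ^ n * norm z * a"] by simp
    also have "\<dots> \<le> 1 / 2 * a"
      using N[OF \<open>N \<le> n\<close>] \<open>a \<ge> 0\<close> by (intro mult_right_mono) auto
    also have "a = norm (complex_of_real (q ^ (n choose 2) / q_fact q n) * z ^ n)"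
      unfolding norm_mult norm_of_real norm_power using assms pos[of n] by (simp add: a_def)
    finally show "norm (complex_of_real (q ^ (Suc n choose 2) / q_fact q (Suc n)) * z ^ Suc n)
      \<le> 1 / 2 * norm (complex_of_real (q ^ (n choose 2) / q_fact q n) * z ^ n)" .
  qed simp
qed

text \<open>Replacing \<open>z\<close> by \<open>q z\<close> scales the n-th term by
  \<open>q ^ n\<close>, so the identity reduces to the coefficient recursion c(n+1) (1 - q^(n+1)) =
  (1 - q) q^n c(n).\<close>

lemma big_q_exp_diff:
  assumes "0 < q" "q < 1"
  shows "big_q_exp q z - big_q_exp q (of_real q * z)
         = of_real (1 - q) * z * big_q_exp q (of_real q * z)"
proof -
  define c where "c n = complex_of_real (q ^ (n choose 2) / q_fact q n)" for n
  define d where "d n = c n * z ^ n - c n * (of_real q * z) ^ n" for n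
  have s: "summable (\<lambda>n. c n * w ^ n)" for w
    unfolding c_def using summable_big_q_exp[OF assms] .
  have E: "big_q_exp q w = (\<Sum>n. c n * w ^ n)" for w
    by (simp add: big_q_exp_def c_def)
  have step: "d (Suc n) = of_real (1 - q) * z * (c n * (of_real q * z) ^ n)" for n
  proof -
    have "q ^ Suc n \<noteq> 1"
      using assms by (metis power_Suc_less_one less_irrefl)
    then have "q ^ (Suc n choose 2) / q_fact q (Suc n) * (1 - q ^ Suc n)
          = (1 - q) * (q ^ (n choose 2) / q_fact q n) * q ^ n"
      using assms q_fact_pos[OF assms, of n]
      by (simp add: q_fact_Suc numeral_2_eq_2 power_add field_simps del: power_Suc)
    then have "c (Suc n) * of_real (1 - q ^ Suc n) = of_real (1 - q) * c n * of_real (q ^ n)"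
      unfolding c_def of_real_mult[symmetric] by (simp only:)
    moreover have "d (Suc n) = c (Suc n) * of_real (1 - q ^ Suc n) * z ^ Suc n"
      by (simp add: d_def power_mult_distrib algebra_simps)
    ultimately show ?thesis
      by (simp add: power_mult_distrib mult_ac)
  qed
  have "summable d"
    unfolding d_def by (intro summable_diff s)
  have "big_q_exp q z - big_q_exp q (of_real q * z) = suminf d"
    unfolding E d_def by (intro suminf_diff s)
  \<comment> \<open>The constant terms cancel, \<open>d 0 = 0\<close>, so the index can be shifted
    by one.\<close>
  also have "\<dots> = (\<Sum>n. d (Suc n))"
    using suminf_split_head[OF \<open>summable d\<close>] by (simp add: d_def)
  also have "\<dots> = of_real (1 - q) * z * big_q_exp q (of_real q * z)"
    unfolding step E by (intro suminf_mult s)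
  finally show ?thesis .
qed

section \<open>First-order q-differences of the transform\<close>

lemma q_laplace2_integrand_diff:
  assumes "0 < q" "q < 1"
  shows "q_laplace2_integrand q g r s x y - q_laplace2_integrand q g (q * r) s x y
         = of_real (- ((1 - q) * q * r)) *
           q_laplace2_integrand q (\<lambda>x y. of_real x * g x y) (q * r) s x y"
proof -
  have "big_q_exp q (of_real (- q * r * x)) - big_q_exp q (of_real (- q * (q * r) * x))
    = of_real (1 - q) * of_real (- q * r * x) * big_q_exp q (of_real (- q * (q * r) * x))"
    using big_q_exp_diff[OF assms, of "of_real (- q * r * x)"] by (simp add: mult_ac)
  then have "g x y * (big_q_exp q (of_real (- q * r * x)) - big_q_exp q (of_real (- q * (q * r) * x)))
      * big_q_exp q (of_real (- q * s * y))
    = g x y * (of_real (1 - q) * of_real (- q * r * x) * big_q_exp q (of_real (- q * (q * r) * x)))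
      * big_q_exp q (of_real (- q * s * y))"
    by (simp only:)
  then show ?thesis
    by (simp add: q_laplace2_integrand_def algebra_simps)
qed

text \<open>By the pointwise identity for the integrand, a nonzero constant times the series for
  \<open>x g\<close> at \<open>q r\<close> is termwise the difference of two absolutely convergent
  series. Convergence is therefore inherited and the sums may be subtracted. Having convergence as a
  conclusion lets the differencing be repeated.\<close>

lemma q_laplace2_diff:
  assumes q: "0 < q" "q < 1" and "r \<noteq> 0"
    and "q_laplace2_converges q g r s" "q_laplace2_converges q g (q * r) s"
  shows q_laplace2_converges_mult:
      "q_laplace2_converges q (\<lambda>x y. of_real x * g x y) (q * r) s"
    and "q_laplace2 q g r s - q_laplace2 q g (q * r) s
      = of_real (- ((1 - q) * q * r)) * q_laplace2 q (\<lambda>x y. of_real x * g x y) (q * r) s"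
proof -
  define T where "T r = jackson2_term q (q_laplace2_integrand q g r s)" for r
  define U where
    "U = jackson2_term q (q_laplace2_integrand q (\<lambda>x y. of_real x * g x y) (q * r) s)"
  define c where "c = complex_of_real (- ((1 - q) * q * r))"
  have c: "c \<noteq> 0"
    unfolding c_def of_real_eq_0_iff using assms by simp
  have eq: "T r p - T (q * r) p = c * U p" for p
  proof -
    obtain i j where "p = (i, j)"
      by (cases p)
    then show ?thesis
      using q_laplace2_integrand_diff[OF q, of g r s "q powi i" "q powi j"]
      by (simp add: T_def U_def c_def jackson2_term_def flip: right_diff_distrib)
  qed
  have s: "(\<lambda>p. norm (T r p)) summable_on UNIV" "(\<lambda>p. norm (T (q * r) p)) summable_on UNIV"
    using assms by (auto simp: q_laplace2_converges_def jackson2_converges_def T_def)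
  have "(\<lambda>p. norm (T r p) + norm (T (q * r) p)) summable_on UNIV"
    using s by (rule summable_on_add)
  then have "(\<lambda>p. norm (c * U p)) summable_on UNIV"
    by (rule Infinite_Sum.abs_summable_on_comparison_test')
      (simp add: norm_triangle_ineq4 flip: eq)
  then show "q_laplace2_converges q (\<lambda>x y. of_real x * g x y) (q * r) s"
    using c
    by (simp add: norm_mult summable_on_cmult_right' q_laplace2_converges_def
        jackson2_converges_def flip: U_def)
  have has_sum: "(T \<rho> has_sum infsum (T \<rho>) UNIV) UNIV"
    if "(\<lambda>p. norm (T \<rho> p)) summable_on UNIV" for \<rho>
    using Infinite_Sum.abs_summable_summable[OF that] by (rule has_sum_infsum)
  have "((\<lambda>p. T r p + - T (q * r) p) has_sum
      infsum (T r) UNIV + - infsum (T (q * r)) UNIV) UNIV"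
    by (rule has_sum_add[OF has_sum[OF s(1)] has_sum_uminusI[OF has_sum[OF s(2)]]])
  then have "infsum (T r) UNIV - infsum (T (q * r)) UNIV = infsum (\<lambda>p. c * U p) UNIV"
    by (simp add: infsumI flip: eq)
  also have "\<dots> = c * infsum U UNIV"
    by (rule infsum_cmult_right')
  finally have "infsum (T r) UNIV - infsum (T (q * r)) UNIV = c * infsum U UNIV" .
  then show "q_laplace2 q g r s - q_laplace2 q g (q * r) s
      = of_real (- ((1 - q) * q * r)) * q_laplace2 q (\<lambda>x y. of_real x * g x y) (q * r) s"
    by (simp only: q_laplace2_def jackson2_integral_def mult.left_commute[of c]
        flip: T_def U_def c_def right_diff_distrib)
qed

text \<open>Only the values of \<open>F\<close> at the points \<open>q\<^sup>i r\<close> matter, since the transform need not converge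
  elsewhere.\<close>

lemma q_laplace2_q_deriv_fst_funpow:
  assumes q: "0 < q" "q < 1" and "c \<noteq> 0" and "r \<noteq> 0"
    and "\<And>i. i \<le> k \<Longrightarrow> q_laplace2_converges q g (c * (q ^ i * r)) t"
    and "\<And>i. i \<le> k \<Longrightarrow> F (q ^ i * r) s = A * q_laplace2 q g (c * (q ^ i * r)) t"
  shows "q_laplace2_converges q (\<lambda>x y. of_real (x ^ k) * g x y) (c * (q ^ k * r)) t \<and>
     (q_deriv_fst q ^^ k) F r s
       = A * of_real ((- c) ^ k * q ^ (Suc k choose 2)) *
         q_laplace2 q (\<lambda>x y. of_real (x ^ k) * g x y) (c * (q ^ k * r)) t"
  using assms(4-)
\<comment> \<open>The outermost q-derivative compares the points \<open>r\<close> and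
  \<open>q * r\<close>; the induction hypothesis is needed at both, hence \<open>r\<close>
  varies.\<close>
proof (induction k arbitrary: r)
  case 0
  from 0(2)[of 0] 0(3)[of 0] show ?case
    by (simp add: numeral_2_eq_2)
next
  case (Suc k)
  define h where "h = (\<lambda>x y. of_real (x ^ k) * g x y)"
  define \<rho> where "\<rho> = c * (q ^ k * r)"
  \<comment> \<open>The prefactor \<open>A\<close> is carried along so that the result can be
    applied a second time, to a function that already has a constant in front of its
    transform.\<close>
  define B where "B = A * of_real ((- c) ^ k * q ^ (Suc k choose 2))"
  have \<rho>: "\<rho> \<noteq> 0"
    using \<open>c \<noteq> 0\<close> \<open>r \<noteq> 0\<close> q by (simp add: \<rho>_def)
  have at_r: "q_laplace2_converges q h \<rho> t"
      "(q_deriv_fst q ^^ k) F r s = B * q_laplace2 q h \<rho> t"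
    using Suc.IH[of r] Suc.prems by (simp_all add: h_def \<rho>_def B_def)
  \<comment> \<open>The sample points of \<open>q * r\<close> with index at most \<open>k\<close>
    are those of \<open>r\<close> with index from 1 to \<open>Suc k\<close>, so the hypotheses for
    \<open>r\<close> cover them.\<close>
  have shift: "q ^ i * (q * r) = q ^ Suc i * r" for i
    by simp
  have "q_laplace2_converges q h (c * (q ^ k * (q * r))) t \<and>
      (q_deriv_fst q ^^ k) F (q * r) s = B * q_laplace2 q h (c * (q ^ k * (q * r))) t"
    unfolding h_def B_def
  proof (rule Suc.IH)
    show "q * r \<noteq> 0"
      using q Suc.prems by simp
  qed (unfold shift, (rule Suc.prems, simp)+)
  moreover have "c * (q ^ k * (q * r)) = q * \<rho>"
    by (simp add: \<rho>_def)
  ultimately have at_qr: "q_laplace2_converges q h (q * \<rho>) t"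
      "(q_deriv_fst q ^^ k) F (q * r) s = B * q_laplace2 q h (q * \<rho>) t"
    by simp_all
  note diff = q_laplace2_diff[OF q \<rho> at_r(1) at_qr(1)]
  have xh: "(\<lambda>x y. of_real x * h x y) = (\<lambda>x y. of_real (x ^ Suc k) * g x y)"
    by (simp add: h_def mult_ac)
  have pt: "q * \<rho> = c * (q ^ Suc k * r)"
    by (simp add: \<rho>_def)
  have "(q_deriv_fst q ^^ Suc k) F r s
      = B * (q_laplace2 q h \<rho> t - q_laplace2 q h (q * \<rho>) t) / of_real ((1 - q) * r)"
    by (simp add: q_deriv_fst_def at_r at_qr right_diff_distrib)
  also have "\<dots> = B * (of_real (- ((1 - q) * q * \<rho>)) / of_real ((1 - q) * r))
      * q_laplace2 q (\<lambda>x y. of_real (x ^ Suc k) * g x y) (c * (q ^ Suc k * r)) t"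
    unfolding diff(2) unfolding xh pt by (simp only: times_divide_eq_right times_divide_eq_left mult.assoc)
  \<comment> \<open>The (k+1)-st derivative contributes \<open>- c * q ^ Suc k\<close>:
    \<open>c\<close> comes from the rescaled argument, and the powers q^1, ..., q^k accumulate to
    the exponent binom(k+1,2).\<close>
  also have "of_real (- ((1 - q) * q * \<rho>)) / of_real ((1 - q) * r) = complex_of_real (- c * q ^ Suc k)"
    unfolding of_real_divide[symmetric] of_real_eq_iff
    using q Suc.prems(1) by (simp add: \<rho>_def field_simps)
  also have "B * \<dots> = A * of_real ((- c) ^ Suc k * q ^ (Suc (Suc k) choose 2))"
    by (simp add: B_def numeral_2_eq_2 power_add mult_ac)
  finally show ?case
    using diff(1) unfolding xh pt by simp
qed

section \<open>Exchange of the two variables, which carries results in \<open>r\<close> over to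
  \<open>s\<close>\<close>

lemma q_laplace2_swap:
  shows q_laplace2_converges_swap:
      "q_laplace2_converges q (\<lambda>y x. g x y) s r \<longleftrightarrow> q_laplace2_converges q g r s"
    and "q_laplace2 q (\<lambda>y x. g x y) s r = q_laplace2 q g r s"
proof -
  have eq: "jackson2_term q (q_laplace2_integrand q (\<lambda>y x. g x y) s r) p
      = jackson2_term q (q_laplace2_integrand q g r s) (prod.swap p)" for p
    by (cases p) (simp add: jackson2_term_def q_laplace2_integrand_def mult_ac)
  have bij: "bij_betw prod.swap (UNIV :: (int \<times> int) set) UNIV"
    by simp
  show "q_laplace2_converges q (\<lambda>y x. g x y) s r \<longleftrightarrow> q_laplace2_converges q g r s"
    unfolding q_laplace2_converges_def jackson2_converges_def eq
    by (rule summable_on_reindex_bij_betw[OF bij])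
  show "q_laplace2 q (\<lambda>y x. g x y) s r = q_laplace2 q g r s"
    unfolding q_laplace2_def jackson2_integral_def eq
    by (subst infsum_reindex_bij_betw[OF bij]) rule
qed

lemma q_deriv_snd_funpow_swap:
  "(q_deriv_snd q ^^ n) F r s = (q_deriv_fst q ^^ n) (\<lambda>s r. F r s) s r"
  by (induction n arbitrary: r s) (simp_all add: q_deriv_fst_def q_deriv_snd_def)

text \<open>The exponents binom(m,2) and binom(m+1,2) add up to m^2, which the power (q^(-m))^m
  cancels; only the sign survives.\<close>

lemma power_choose_2_shift:
  fixes q :: real
  assumes "q \<noteq> 0"
  shows "q ^ (m choose 2) * ((- (q powi (- int m))) ^ m * q ^ (Suc m choose 2)) = (- 1) ^ m"
proof -
  have "(m choose 2) + (Suc m choose 2) = m * m"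
    by (induction m) (simp_all add: numeral_2_eq_2)
  then have "q ^ (m choose 2) * q ^ (Suc m choose 2) = (q ^ m) ^ m"
    by (simp flip: power_add power_mult)
  moreover have "(- (q powi (- int m))) ^ m = (- 1) ^ m / (q ^ m) ^ m"
    by (simp add: power_int_minus power_minus[of "inverse _"] power_inverse divide_inverse)
  ultimately show ?thesis
    using assms by (simp add: mult.left_commute)
qed

theorem theorem3p13:
  fixes q r s :: real and m n :: nat and f :: "real \<Rightarrow> real \<Rightarrow> complex"
  assumes "0 < q" and "q < 1" and "0 < r" and "0 < s"
    and "q_laplace2_converges q (\<lambda>x y. complex_of_real (x ^ m * y ^ n) * f x y) r s"
    and "\<And>i j. i \<le> m \<Longrightarrow> j \<le> n \<Longrightarrow>
           q_laplace2_converges q f (q powi (- int i) * r) (q powi (- int j) * s)"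
  shows "q_laplace2 q (\<lambda>x y. complex_of_real (x ^ m * y ^ n) * f x y) r s =
         (- 1) ^ (m + n) * complex_of_real (q ^ ((m choose 2) + (n choose 2))) *
         (q_deriv_snd q ^^ n) ((q_deriv_fst q ^^ m)
            (\<lambda>r' s'. q_laplace2 q f (q powi (- int m) * r') (q powi (- int n) * s'))) r s"
proof -
  define a where "a m = q powi (- int m)" for m
  define C where "C k = (- a k) ^ k * q ^ (Suc k choose 2)" for k
  define F where "F = (\<lambda>r' s'. q_laplace2 q f (a m * r') (a n * s'))"
  define h where "h = (\<lambda>x y. of_real (x ^ m) * f x y)"
  have a: "a k \<noteq> 0" "a k * (q ^ k * t) = t" for k t
    using assms by (simp_all add: a_def power_int_minus)
  \<comment> \<open>Under the shift by \<open>a k\<close>, the points sampled by the q-derivatives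
    become exactly those at which convergence is assumed, with the index reversed from
    \<open>i\<close> to \<open>k - i\<close>.\<close>
  have a_diff: "a k * (q ^ i * t) = q powi (- int (k - i)) * t" if "i \<le> k" for k i t
  proof -
    have "a k * q ^ i = q powi (- int k + int i)"
      using assms power_int_add[of q "- int k" "int i"] by (simp add: a_def)
    then show ?thesis
      using that by (simp add: of_nat_diff flip: mult.assoc)
  qed
  have conv: "q_laplace2_converges q f (a m * (q ^ i * r)) (a n * (q ^ j * s))"
    if "i \<le> m" "j \<le> n" for i j
    unfolding a_diff[OF that(1)] a_diff[OF that(2)] by (rule assms(6)) auto
  \<comment> \<open>The \<open>n\<close> derivatives in \<open>s\<close> sample only the points
    \<open>q ^ j * s\<close> with \<open>j \<le> n\<close>, so the derivatives in \<open>r\<close>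
    are computed there. The convergence part serves as hypothesis for the derivatives in
    \<open>s\<close>.\<close>
  have fst: "q_laplace2_converges q h r (a n * (q ^ j * s)) \<and>
      (q_deriv_fst q ^^ m) F r (q ^ j * s) = of_real (C m) * q_laplace2 q h r (a n * (q ^ j * s))"
    if "j \<le> n" for j
    using q_laplace2_q_deriv_fst_funpow[of q "a m" r m f "a n * (q ^ j * s)" F "q ^ j * s" 1,
        OF assms(1,2) a(1) _ conv[OF _ that]] \<open>0 < r\<close>
    by (simp add: F_def h_def C_def a(2))
  \<comment> \<open>Second application of the same lemma with the variables exchanged:
    \<open>h\<close> replaces \<open>f\<close>, and \<open>C m\<close> from the first application is
    the prefactor.\<close>
  have "(q_deriv_snd q ^^ n) ((q_deriv_fst q ^^ m) F) r s
      = of_real (C m) * of_real (C n) * q_laplace2 q (\<lambda>y x. of_real (y ^ n) * h x y) s r"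
    unfolding q_deriv_snd_funpow_swap
    using q_laplace2_q_deriv_fst_funpow[of q "a n" s n "\<lambda>y x. h x y" r
        "\<lambda>s r. (q_deriv_fst q ^^ m) F r s" r "of_real (C m)", OF assms(1,2) a(1)]
      fst \<open>0 < s\<close> by (simp add: q_laplace2_swap[of q h] C_def a(2))
  also have "q_laplace2 q (\<lambda>y x. of_real (y ^ n) * h x y) s r
      = q_laplace2 q (\<lambda>x y. of_real (x ^ m * y ^ n) * f x y) r s"
    unfolding q_laplace2_swap(2)[of q "\<lambda>x y. of_real (y ^ n) * h x y"]
    by (simp add: h_def mult_ac)
  finally have D: "(q_deriv_snd q ^^ n) ((q_deriv_fst q ^^ m) F) r s
      = of_real (C m) * of_real (C n) * q_laplace2 q (\<lambda>x y. of_real (x ^ m * y ^ n) * f x y) r s" .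
  \<comment> \<open>Each constant \<open>C k\<close> is cancelled by its power of \<open>q\<close>
    up to the sign (-1)^k; the two signs together are squared away by the prefactor
    (-1)^(m+n).\<close>
  have "q ^ (k choose 2) * C k = (- 1) ^ k" for k
    unfolding C_def a_def using assms by (intro power_choose_2_shift) simp
  then have "(- 1) ^ (m + n) * q ^ ((m choose 2) + (n choose 2)) * (C m * C n)
      = (- 1) ^ (m + n) * ((- 1) ^ m * (- 1) ^ n)"
    by (metis (no_types, lifting) mult.assoc mult.left_commute power_add)
  also have "\<dots> = 1"
    by (simp flip: power_add)
  finally have "complex_of_real ((- 1) ^ (m + n) * q ^ ((m choose 2) + (n choose 2)) * (C m * C n)) = 1"
    by simp
  then have "(- 1) ^ (m + n) * complex_of_real (q ^ ((m choose 2) + (n choose 2))) *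
      (q_deriv_snd q ^^ n) ((q_deriv_fst q ^^ m) F) r s
      = q_laplace2 q (\<lambda>x y. of_real (x ^ m * y ^ n) * f x y) r s"
    unfolding D by (simp add: mult.assoc[symmetric])
  then show ?thesis
    by (simp add: F_def a_def)
qed

end
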